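(* Let $n$ be a positive integer. Then $\varphi_8(n)$ is odd if and only if $n=8$, $n=16$, or $n$ is of one of the following forms, where $p,p_1,p_2$ denote odd primes with $p_1\ne p_2$ and $\alpha,\alpha_1,\alpha_2$ denote positive integers: (1) $n=p^{\alpha}$ with $p\equiv 9$ or $15\pmod{16}$; or $p\equiv 3$ or $5\pmod{16}$ and $\alpha$ even; or $p\equiv 11$ or $13\pmod{16}$ and $\alpha$ odd; (2) $n=2p^{\alpha}$ with $p\equiv 7$ or $9\pmod{16}$; or $p\equiv 3$ or $13\pmod{16}$ and $\alpha$ even; or $p\equiv 5$ or $11\pmod{16}$ and $\alpha$ odd; (3) $n=4p^{\alpha}$ with $p\equiv 3$ or $5\pmod 8$; (4) $n=8p^{\alpha}$ with $p\equiv 3$ or $7\pmod 8$; (5) $n=p_1^{\alpha_1}p_2^{\alpha_2}$ with $p_1\equiv p_2\equiv 3\pmod 8$, or $p_1\equiv p_2\equiv5\pmod 8$, or $p_1\equiv 3\pmod 8$ and $p_2\equiv 5\pmod 8$; (6) $n=2p_1^{\alpha_1}p_2^{\alpha_2}$ with $p_1\equiv p_2\equiv 3\pmod 8$, or $p_1\equiv p_2\equiv5\pmod 8$, or $p_1\equiv 3\pmod 8$ and $p_2\equiv 5\pmod 8$.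
   Context: For positive integers $n,e$, the generalized Euler function is $\varphi_e(n)=\#\{i\in\mathbb{Z}: 1\le i\le \lfloor n/e\rfloor,\ \gcd(i,n)=1\}$, where $\lfloor x\rfloor$ is the greatest integer not exceeding $x$. *)

theory Defs
  imports Complex_Main "HOL-Number_Theory.Number_Theory"
begin

(* Intended for e, n > 0. *)
definition gen_euler_phi :: "nat \<Rightarrow> nat \<Rightarrow> nat" where
  "gen_euler_phi e n =
     card {i :: int. 1 \<le> i \<and> i \<le> \<lfloor>real n / real e\<rfloor> \<and> gcd i (int n) = 1}"

end

theory Submission
  imports Defs
begin

text \<open>
  By inclusion-exclusion modulo 2, \<open>\<phi>\<^sub>8(n)\<close> has the parity of \<open>\<Sum>\<^bsub>d\<^esub> \<lfloor>n / (8 d)\<rfloor>\<close> over the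
  squarefree divisors \<open>d\<close> of \<open>n\<close>.  Write \<open>n = 2\<^sup>v m\<close> with \<open>m\<close> odd; pairing \<open>d\<close> with \<open>2 d\<close> leaves the
  sum of \<open>h(m / d)\<close> over the squarefree \<open>d\<close> dividing \<open>m\<close>, for a function \<open>h\<close> (depending on \<open>v\<close>) on
  the odd residues modulo 16.  Modulo 2, \<open>h(u w) = h(u) + h(w) + h(1) + c \<chi>(u) \<chi>(w)\<close> where
  \<open>(-1)\<^bsup>\<chi>(u)\<^esup>\<close> is the Jacobi symbol \<open>(2/u)\<close> and \<open>c = 1\<close> iff \<open>v \<le> 1\<close>.  So \<open>h\<close> is a
  polynomial of degree at most two on the unit group, and the sum is an iterated difference of \<open>h\<close>
  with one step per prime factor of \<open>m\<close>: it vanishes for three or more primes, equals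
  \<open>c \<chi>(p) \<chi>(q)\<close> for two, and \<open>h(p) + h(1) + c (\<alpha> - 1) \<chi>(p)\<close> for \<open>m = p\<^sup>\<alpha>\<close>.
\<close>

section \<open>Inclusion-exclusion modulo 2\<close>

definition sieve_sum :: "nat set \<Rightarrow> (nat \<Rightarrow> nat) \<Rightarrow> nat \<Rightarrow> nat" where
  "sieve_sum P f n = (\<Sum>A\<in>Pow P. f (n div \<Prod>A))"

lemma sieve_sum_empty [simp]: "sieve_sum {} f n = f n"
  by (simp add: sieve_sum_def)

text \<open>Subsets avoiding \<open>p\<close> contribute \<open>f k\<close>, those containing it
  \<open>f (k div p)\<close>. Changing the function and keeping \<open>n\<close> lets primes be
  peeled off one at a time; modulo 2 each peeling acts as a difference operator.\<close>

lemma sieve_sum_insert: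
  assumes "finite P" "p \<notin> P"
  shows "sieve_sum (insert p P) f n = sieve_sum P (\<lambda>k. f k + f (k div p)) n"
proof -
  have inj: "inj_on (insert p) (Pow P)"
    using assms(2) by (auto simp: inj_on_def)
  have "sieve_sum (insert p P) f n =
      (\<Sum>A\<in>Pow P. f (n div \<Prod>A)) + (\<Sum>A\<in>insert p ` Pow P. f (n div \<Prod>A))"
    unfolding sieve_sum_def Pow_insert
    using assms by (intro sum.union_disjoint) auto
  also have "(\<Sum>A\<in>insert p ` Pow P. f (n div \<Prod>A)) = (\<Sum>A\<in>Pow P. f (n div \<Prod>(insert p A)))"
    using inj by (simp add: sum.reindex)
  also have "\<dots> = (\<Sum>A\<in>Pow P. f (n div \<Prod>A div p))"
  proof (rule sum.cong)
    fix A assume "A \<in> Pow P"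
    then have "finite A" "p \<notin> A" using assms finite_subset by auto
    then show "f (n div \<Prod>(insert p A)) = f (n div \<Prod>A div p)"
      by (simp add: div_mult2_eq [symmetric] mult.commute)
  qed simp
  finally show ?thesis by (simp add: sieve_sum_def sum.distrib)
qed

text \<open>Legendre's inclusion-exclusion count, whose signs disappear modulo 2. The induction
  discards the multiples of the new prime from the numbers that survive \<open>P\<close>.\<close>

lemma card_sieve_parity:
  assumes "finite P" "\<And>p. p \<in> P \<Longrightarrow> prime p"
  shows "even (card {i \<in> {1..x}. \<forall>p\<in>P. \<not> p dvd i}) \<longleftrightarrow> even (sieve_sum P (\<lambda>k. k) x)"
  using assms
proof (induction P arbitrary: x rule: finite_induct)
  case empty
  have "{i \<in> {1..x}. \<forall>p\<in>{}. \<not> p dvd i} = {1..x}" by auto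
  then show ?case by (simp only: card_atLeastAtMost sieve_sum_empty) simp
next
  case (insert p P)
  have p: "p > 0" using insert.prems by (simp add: prime_gt_0_nat)
  define C where "C x = {i \<in> {1..x}. \<forall>q\<in>P. \<not> q dvd i}" for x
  have fin: "finite (C x)" for x by (simp add: C_def)
  have ndvd: "\<not> q dvd p" if "q \<in> P" for q
    using insert.prems insert.hyps that primes_dvd_imp_eq by blast
  \<comment> \<open>No prime of \<open>P\<close> divides \<open>p\<close>, so \<open>p * j\<close>
    survives the sieve by \<open>P\<close> exactly when \<open>j\<close> does.\<close>
  have "{i \<in> C x. p dvd i} = (\<lambda>j. p * j) ` C (x div p)"
  proof (rule equalityI; rule subsetI)
    fix i assume "i \<in> {i \<in> C x. p dvd i}"
    then obtain j where "i = p * j" "i \<in> C x" by auto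
    then show "i \<in> (\<lambda>j. p * j) ` C (x div p)"
      using p by (intro image_eqI [of _ _ j]) (auto simp: C_def less_eq_div_iff_mult_less_eq mult.commute)
  next
    fix i assume "i \<in> (\<lambda>j. p * j) ` C (x div p)"
    then show "i \<in> {i \<in> C x. p dvd i}"
      using p ndvd insert.prems
      by (auto simp: C_def less_eq_div_iff_mult_less_eq mult.commute prime_dvd_mult_iff)
  qed
  then have "card {i \<in> C x. p dvd i} = card (C (x div p))"
    using p by (simp add: card_image inj_on_def)
  moreover have "card (C x) = card {i \<in> C x. p dvd i} + card {i \<in> C x. \<not> p dvd i}"
    by (subst card_Un_disjoint [symmetric]) (auto simp: fin intro: arg_cong [where f = card])
  moreover have "{i \<in> C x. \<not> p dvd i} = {i \<in> {1..x}. \<forall>q\<in>insert p P. \<not> q dvd i}"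
    by (auto simp: C_def)
  ultimately have "even (card (C x)) \<longleftrightarrow>
      even (card (C (x div p)) + card {i \<in> {1..x}. \<forall>q\<in>insert p P. \<not> q dvd i})"
    by simp
  moreover have "even (card (C y)) \<longleftrightarrow> even (sieve_sum P (\<lambda>k. k) y)" for y
    unfolding C_def using insert by simp
  \<comment> \<open>Successive floor divisions commute, so the terms with \<open>k div p\<close>
    form the sieve at \<open>x div p\<close>.\<close>
  moreover have "sieve_sum (insert p P) (\<lambda>k. k) x = sieve_sum P (\<lambda>k. k) x + sieve_sum P (\<lambda>k. k) (x div p)"
    unfolding sieve_sum_insert [OF insert.hyps]
    by (simp add: sieve_sum_def sum.distrib div_mult2_eq [symmetric] mult.commute)
  ultimately show ?case by (simp only: even_add) blast
qed

lemma coprime_iff_prime_factors: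
  fixes i n :: nat
  assumes "n > 0"
  shows "coprime i n \<longleftrightarrow> (\<forall>p\<in>prime_factors n. \<not> p dvd i)"
proof
  assume "coprime i n"
  then show "\<forall>p\<in>prime_factors n. \<not> p dvd i"
    by (metis coprime_common_divisor in_prime_factors_imp_dvd in_prime_factors_imp_prime not_prime_unit)
next
  assume *: "\<forall>p\<in>prime_factors n. \<not> p dvd i"
  show "coprime i n"
  proof (rule ccontr)
    assume "\<not> coprime i n"
    then obtain p where "prime p" "p dvd gcd i n"
      by (metis coprime_iff_gcd_eq_1 prime_factor_nat)
    with * assms show False by (auto simp: prime_factors_dvd)
  qed
qed

lemma gen_euler_phi_nat:
  "gen_euler_phi e n = card {i \<in> {1..n div e}. coprime i n}"
proof -
  have fl: "\<lfloor>real n / real e\<rfloor> = int (n div e)"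
    by (simp add: floor_divide_of_nat_eq)
  have "{i :: int. 1 \<le> i \<and> i \<le> \<lfloor>real n / real e\<rfloor> \<and> gcd i (int n) = 1} =
      int ` {i \<in> {1..n div e}. coprime i n}" (is "?A = ?B")
  proof (rule equalityI; rule subsetI)
    fix i assume i: "i \<in> ?A"
    then have "0 \<le> i" by simp
    then obtain j where "i = int j" by (rule nonneg_int_cases)
    with i show "i \<in> ?B" unfolding fl by (simp add: coprime_iff_gcd_eq_1 [symmetric])
  next
    fix i assume "i \<in> ?B"
    then show "i \<in> ?A" unfolding fl by (auto simp: coprime_iff_gcd_eq_1 [symmetric])
  qed
  then show ?thesis
    by (simp add: gen_euler_phi_def card_image)
qed

lemma gen_euler_phi_parity:
  assumes "n > 0"
  shows "even (gen_euler_phi e n) \<longleftrightarrow> even (sieve_sum (prime_factors n) (\<lambda>k. k div e) n)"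
proof -
  have "sieve_sum (prime_factors n) (\<lambda>k. k div e) n = sieve_sum (prime_factors n) (\<lambda>k. k) (n div e)"
    by (simp add: sieve_sum_def div_mult2_eq [symmetric] mult.commute)
  then show ?thesis
    using card_sieve_parity [of "prime_factors n" "n div e"] in_prime_factors_imp_prime
    by (auto simp: gen_euler_phi_nat coprime_iff_prime_factors [OF assms])
qed

section \<open>Parity of the quotients on odd residues modulo 16\<close>

text \<open>For odd \<open>k\<close>, the Jacobi symbol \<open>(2/k)\<close> is \<open>(-1) ^ two_char k\<close>.\<close>
definition two_char :: "nat \<Rightarrow> nat" where
  "two_char k = (if k mod 8 \<in> {3, 5} then 1 else 0)"

text \<open>If \<open>n = 2 ^ v * m\<close> with \<open>m\<close> odd, this collects the terms of the sieve for \<open>A\<close> and \<open>insert 2 A\<close>.\<close>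
definition oct_sum :: "nat \<Rightarrow> nat \<Rightarrow> nat" where
  "oct_sum v k = 2 ^ v * k div 8 + (if v = 0 then 0 else 2 ^ (v - 1) * k div 8)"

lemma odd_mod_16:
  assumes "odd (k::nat)"
  shows "k mod 16 \<in> {1, 3, 5, 7, 9, 11, 13, 15}"
proof -
  have "k mod 16 < 16" "odd (k mod 16)" using assms by (auto simp: dvd_mod_iff)
  then have "k mod 16 \<in> set (filter odd [0..<16])" by simp
  also have "filter odd [0..<16] = [1, 3, 5, 7, 9, 11, 13, 15::nat]"
    by code_simp
  finally show ?thesis by simp
qed

lemma even_div_8: "even (k div 8) \<longleftrightarrow> k mod 16 < (8::nat)"
  by presburger

lemma even_div_4: "even (k div 4) \<longleftrightarrow> k mod 8 < (4::nat)"
  by presburger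

lemma even_div_2: "even (k div 2) \<longleftrightarrow> k mod 4 < (2::nat)"
  by presburger

lemma mod_16_mod: "k mod 8 = k mod 16 mod 8" "k mod 4 = k mod 16 mod 4" for k :: nat
  by (simp_all add: mod_mod_cancel)

text \<open>For \<open>v = 4\<close> the sum is \<open>2 * k + k\<close>, hence odd; from
  \<open>v = 5\<close> on both quotients are even. Only for smaller \<open>v\<close> does the
  residue of \<open>k\<close> matter.\<close>

lemma even_oct_sum:
  assumes "odd k"
  shows "even (oct_sum v k) \<longleftrightarrow>
    (if v = 0 then k mod 16 \<in> {1, 3, 5, 7}
     else if v = 1 then k mod 16 \<in> {1, 3, 13, 15}
     else if v = 2 then k mod 16 \<in> {1, 7, 9, 15}
     else if v = 3 then k mod 16 \<in> {3, 7, 11, 15}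
     else v > 4)"
proof -
  have *: "2 * k div 8 = k div 4" "4 * k div 8 = k div 2" by presburger+
  consider "v = 0" | "v = 1" | "v = 2" | "v = 3" | "v = 4" | "v > 4" by linarith
  then show ?thesis
  proof cases
    case 1
    then show ?thesis using odd_mod_16 [OF assms] by (auto simp: oct_sum_def even_div_8)
  next
    case 2
    then show ?thesis using odd_mod_16 [OF assms]
      by (auto simp: oct_sum_def * even_div_8 even_div_4 mod_16_mod[of k])
  next
    case 3
    then show ?thesis using odd_mod_16 [OF assms]
      by (auto simp: oct_sum_def * even_div_2 even_div_4 mod_16_mod[of k])
  next
    case 4
    then show ?thesis using odd_mod_16 [OF assms] assms
      by (auto simp: oct_sum_def * even_div_2 mod_16_mod[of k])
  next
    case 5
    then show ?thesis using assms by (simp add: oct_sum_def)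
  next
    case 6
    then obtain w where "v = 5 + w" using less_eqE[of 5 v] by auto
    then show ?thesis by (simp add: oct_sum_def power_add)
  qed
qed

lemma two_char_eq:
  assumes "odd k"
  shows "two_char k = (if k mod 16 \<in> {3, 5, 11, 13} then 1 else 0)"
  using odd_mod_16 [OF assms] unfolding two_char_def mod_16_mod [of k] by auto

text \<open>Multiplicativity of the Jacobi symbol, verified on the 64 pairs of odd residues modulo
  16.\<close>

lemma two_char_mult:
  assumes "odd u" "odd w"
  shows "even (two_char (u * w)) \<longleftrightarrow> even (two_char u + two_char w)"
proof -
  have "odd (u * w)" using assms by simp
  note e = two_char_eq [OF assms(1)] two_char_eq [OF assms(2)] two_char_eq [OF this]
  show ?thesis
    using odd_mod_16 [OF assms(1)] odd_mod_16 [OF assms(2)]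
    unfolding e mod_mult_eq [of u 16 w, symmetric] by (elim insertE emptyE; simp only:; simp)
qed

text \<open>For each \<open>v \<le> 3\<close> all parities involved depend only on residues modulo
  16, so 64 pairs are checked. For \<open>v \<ge> 4\<close> the parity of \<open>oct_sum v\<close>
  is the same at all odd arguments and no bilinear term occurs.\<close>

lemma oct_sum_mult:
  assumes "odd u" "odd w"
  shows "even (oct_sum v (u * w)) \<longleftrightarrow> even (oct_sum v u + oct_sum v w + oct_sum v 1 +
    (if v \<le> 1 then two_char u * two_char w else 0))"
proof -
  have "odd (u * w)" "odd (1::nat)" using assms by auto
  note e = even_oct_sum [OF assms(1)] even_oct_sum [OF assms(2)] even_oct_sum [OF this(1)] even_oct_sum [OF this(2)]
    two_char_eq [OF assms(1)] two_char_eq [OF assms(2)]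
  consider "v = 0" | "v = 1" | "v = 2" | "v = 3" | "v \<ge> 4" by linarith
  then show ?thesis
  proof cases
    case 1
    show ?thesis
      using odd_mod_16 [OF assms(1)] odd_mod_16 [OF assms(2)]
      unfolding even_add e mod_mult_eq [of u 16 w, symmetric] 1
      by (elim insertE emptyE; simp only:; simp)
  next
    case 2
    show ?thesis
      using odd_mod_16 [OF assms(1)] odd_mod_16 [OF assms(2)]
      unfolding even_add e mod_mult_eq [of u 16 w, symmetric] 2
      by (elim insertE emptyE; simp only:; simp)
  next
    case 3
    show ?thesis
      using odd_mod_16 [OF assms(1)] odd_mod_16 [OF assms(2)]
      unfolding even_add e mod_mult_eq [of u 16 w, symmetric] 3
      by (elim insertE emptyE; simp only:; simp)
  next
    case 4
    show ?thesis
      using odd_mod_16 [OF assms(1)] odd_mod_16 [OF assms(2)]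
      unfolding even_add e mod_mult_eq [of u 16 w, symmetric] 4
      by (elim insertE emptyE; simp only:; simp)
  next
    case 5
    then show ?thesis
      unfolding even_add e by (cases "v = 4") auto
  qed
qed

section \<open>Splitting off the prime 2\<close>

lemma prod_primes_dvd:
  fixes A :: "nat set"
  assumes "A \<subseteq> prime_factors n"
  shows "\<Prod>A dvd n"
proof -
  have "finite A" using assms finite_subset by auto
  then show ?thesis using assms
  proof (induction A rule: finite_induct)
    case (insert p A)
    have "coprime p (\<Prod>A)"
      using insert by (intro prod_coprime_right primes_coprime) auto
    with insert show ?case by (auto intro: divides_mult)
  qed simp
qed

text \<open>For \<open>v > 0\<close> the prime 2 is peeled off first. Division by \<Prod>A is exact
  and leaves \<open>2 ^ v\<close> intact, so the terms for \<open>A\<close> and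
  \<open>insert 2 A\<close> merge into \<open>oct_sum v\<close>.\<close>

lemma gen_euler_phi_8_parity:
  assumes "odd m"
  shows "even (gen_euler_phi 8 (2 ^ v * m)) \<longleftrightarrow> even (sieve_sum (prime_factors m) (oct_sum v) m)"
proof (cases "v = 0")
  case True
  moreover have "oct_sum 0 = (\<lambda>k. k div 8)" by (simp add: oct_sum_def fun_eq_iff)
  moreover have "m > 0" using assms by (intro Nat.gr0I) auto
  ultimately show ?thesis using gen_euler_phi_parity [of m 8] by simp
next
  case False
  have m: "m > 0" using assms by (intro Nat.gr0I) auto
  have pf: "prime_factors (2 ^ v * m) = insert 2 (prime_factors m)"
    using False m by (simp add: prime_factors_product prime_factors_power prime_prime_factors)
  have "sieve_sum (prime_factors (2 ^ v * m)) (\<lambda>k. k div 8) (2 ^ v * m) =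
      sieve_sum (prime_factors m) (\<lambda>k. k div 8 + k div 2 div 8) (2 ^ v * m)"
    unfolding pf using assms by (intro sieve_sum_insert) auto
  also have "\<dots> = sieve_sum (prime_factors m) (oct_sum v) m"
    unfolding sieve_sum_def
  proof (rule sum.cong)
    fix A assume "A \<in> Pow (prime_factors m)"
    then have "2 ^ v * m div \<Prod>A = 2 ^ v * (m div \<Prod>A)"
      using prod_primes_dvd by (simp add: div_mult_swap)
    moreover have "2 ^ v * (m div \<Prod>A) div 2 = 2 ^ (v - 1) * (m div \<Prod>A)"
      using False by (cases v) auto
    ultimately show "2 ^ v * m div \<Prod>A div 8 + 2 ^ v * m div \<Prod>A div 2 div 8 = oct_sum v (m div \<Prod>A)"
      using False by (simp add: oct_sum_def)
  qed simp
  finally show ?thesis using gen_euler_phi_parity [of "2 ^ v * m" 8] m by simp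
qed

section \<open>Iterated differences and the number of odd prime factors\<close>

lemma oct_sum_diff:
  assumes "odd u" "odd w"
  shows "odd (oct_sum v (u * w) + oct_sum v w) \<longleftrightarrow>
    odd (oct_sum v u + oct_sum v 1 + (if v \<le> 1 then two_char u * two_char w else 0))"
  using oct_sum_mult [OF assms, of v]
  by (cases "even (oct_sum v w)"; cases "even (oct_sum v u)"; simp)

text \<open>The difference in direction \<open>u\<close> depends on its base point only through
  \<open>two_char\<close>. Between the base points \<open>w * t\<close> and \<open>t\<close> the
  constants cancel and multiplicativity leaves \<open>two_char w\<close>, so \<open>t\<close> drops
  out.\<close>

lemma oct_sum_diff2:
  assumes "odd u" "odd w" "odd t"
  shows "odd (oct_sum v (u * w * t) + oct_sum v (w * t) + (oct_sum v (u * t) + oct_sum v t)) \<longleftrightarrow>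
    v \<le> 1 \<and> odd (two_char u * two_char w)"
proof -
  have "odd (w * t)" using assms by simp
  then show ?thesis
    unfolding mult.assoc even_add [of "oct_sum v (u * (w * t)) + oct_sum v (w * t)"]
    using oct_sum_diff [OF assms(1) \<open>odd (w * t)\<close>, of v] oct_sum_diff [OF assms(1,3), of v]
      two_char_mult [OF assms(2,3)]
    by (cases "v \<le> 1"; cases "even (two_char w)"; cases "even (two_char t)";
        cases "even (oct_sum v u + oct_sum v 1)"; simp only: even_add even_mult_iff if_True if_False; blast)
qed

text \<open>Second differences do not depend on the base point, so third differences vanish. Peeling
  three primes already makes every remaining term even.\<close>

lemma gen_euler_phi_8_many_primes:
  assumes "odd m" "card (prime_factors m) \<ge> 3"
  shows "even (gen_euler_phi 8 (2 ^ v * m))"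
proof -
  obtain p q r Q where Q: "prime_factors m = insert p (insert q (insert r Q))" "finite Q"
    and new: "p \<notin> insert q (insert r Q)" "q \<notin> insert r Q" "r \<notin> Q"
    using assms(2) by (auto simp: numeral_3_eq_3 card_le_Suc_iff)
  have fin: "finite (insert q (insert r Q))" "finite (insert r Q)" using Q by auto
  let ?h = "oct_sum v"
  have "even (?h k + ?h (k div p) + (?h (k div q) + ?h (k div q div p)) +
      (?h (k div r) + ?h (k div r div p) + (?h (k div r div q) + ?h (k div r div q div p))))"
    if "A \<subseteq> Q" and k: "k = m div \<Prod>A" for A k
  proof -
    have A: "finite A" "p \<notin> A" "q \<notin> A" "r \<notin> A" "p \<noteq> q" "p \<noteq> r" "q \<noteq> r"
      using that Q new finite_subset by auto
    have sub: "insert p (insert q (insert r A)) \<subseteq> prime_factors m" using that Q by auto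
    have "\<Prod>(insert p (insert q (insert r A))) dvd m" by (rule prod_primes_dvd [OF sub])
    then obtain t where t: "m = p * q * r * \<Prod>A * t" using A by (auto simp: dvd_def mult.assoc)
    have pos: "\<Prod>A > 0" "p > 0" "q > 0" "r > 0" and odds: "odd p" "odd q" "odd r" "odd t"
      using assms(1) unfolding t by (auto intro!: Nat.gr0I)
    \<comment> \<open>The eight arguments are \<open>t\<close> times the subproducts of
      \<open>p\<close>, \<open>q\<close>, \<open>r\<close>: two second differences in directions
      \<open>p\<close> and \<open>q\<close>, at base points \<open>r * t\<close> and
      \<open>t\<close>.\<close>
    have k': "k = p * q * (r * t)" using pos by (simp add: k t mult_ac)
    have quot: "k div p = q * (r * t)" "k div q = p * (r * t)" "p * (r * t) div p = r * t"
      "k div r = p * q * t" "p * q * t div p = q * t" "p * q * t div q = p * t" "p * t div p = t"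
      using pos unfolding k' by (simp_all add: mult_ac)
    have "odd (r * t)" using odds by simp
    show ?thesis
      using oct_sum_diff2 [OF odds(1,2) \<open>odd (r * t)\<close>, of v] oct_sum_diff2 [OF odds(1,2,4), of v]
      unfolding quot k' [symmetric] by (subst even_add) blast
  qed
  then have "even (sieve_sum (prime_factors m) ?h m)"
    unfolding Q sieve_sum_insert [OF fin(1) new(1)] sieve_sum_insert [OF fin(2) new(2)]
      sieve_sum_insert [OF Q(2) new(3)]
    unfolding sieve_sum_def by (intro dvd_sum) auto
  then show ?thesis using gen_euler_phi_8_parity assms by simp
qed

text \<open>The sieve is one second difference in directions \<open>p\<close> and \<open>q\<close>,
  so the exponents, which enter only through the base point \<open>t\<close>, do not affect the
  parity.\<close>

lemma gen_euler_phi_8_two_primes: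
  assumes "prime p" "odd p" "prime q" "odd q" "p \<noteq> q" "a > 0" "b > 0"
  shows "odd (gen_euler_phi 8 (2 ^ v * (p ^ a * q ^ b))) \<longleftrightarrow>
    v \<le> 1 \<and> p mod 8 \<in> {3, 5} \<and> q mod 8 \<in> {3, 5}"
proof -
  define t where "t = p ^ (a - 1) * q ^ (b - 1)"
  let ?m = "p ^ a * q ^ b"
  have pos: "p > 0" "q > 0" using assms by (auto simp: prime_gt_0_nat)
  have t: "?m = p * q * t" "odd t"
    using assms by (auto simp: t_def gr0_conv_Suc)
  have "prime_factors ?m = {p, q}"
    using assms pos by (auto simp: prime_factors_product prime_factors_power prime_prime_factors)
  moreover have "?m div p = q * t" "?m div q = p * t" "?m div q div p = t"
    using pos by (simp_all add: t(1) mult.assoc mult.left_commute [of p q])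
  then have "sieve_sum {p, q} (oct_sum v) ?m =
      oct_sum v (p * q * t) + oct_sum v (q * t) + (oct_sum v (p * t) + oct_sum v t)"
    using assms(5) sieve_sum_insert [of "{q}" p] sieve_sum_insert [of "{}" q]
    by (simp add: t(1) [symmetric])
  ultimately show ?thesis
    using gen_euler_phi_8_parity [of ?m v] oct_sum_diff2 [OF assms(2,4) t(2), of v] assms
    by (simp add: two_char_def split: if_splits)
qed

lemma two_char_power:
  assumes "odd u"
  shows "odd (two_char (u ^ k)) \<longleftrightarrow> odd k \<and> odd (two_char u)"
proof (induction k)
  case 0
  then show ?case by (simp add: two_char_def)
next
  case (Suc k)
  then show ?case using two_char_mult [of u "u ^ k"] assms by auto
qed

text \<open>The sieve is one first difference at base point \<open>p ^ (a - 1)\<close>. The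
  character there has the parity of \<open>(a - 1) * two_char p\<close>, which is where conditions
  on the parity of the exponent come from.\<close>

lemma gen_euler_phi_8_prime_power:
  assumes "prime p" "odd p" "a > 0"
  shows "odd (gen_euler_phi 8 (2 ^ v * p ^ a)) \<longleftrightarrow>
    odd (oct_sum v p + oct_sum v 1 + (if v \<le> 1 then (a - 1) * two_char p else 0))"
proof -
  have pos: "p > 0" using assms by (auto simp: prime_gt_0_nat)
  have pa: "p ^ a = p * p ^ (a - 1)" using assms by (cases a) auto
  have "prime_factors (p ^ a) = insert p {}"
    using assms by (simp add: prime_factors_power prime_prime_factors)
  moreover have "sieve_sum (insert p {}) (oct_sum v) (p ^ a) = oct_sum v (p * p ^ (a - 1)) + oct_sum v (p ^ (a - 1))"
    using pos by (subst sieve_sum_insert) (simp_all add: pa)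
  ultimately show ?thesis
    using gen_euler_phi_8_parity [of "p ^ a" v] oct_sum_diff [of p "p ^ (a - 1)" v] assms
      two_char_power [of p "a - 1"]
    by auto
qed

lemma gen_euler_phi_8_prime_power_cases:
  assumes "prime p" "odd p" "a > 0"
  shows "odd (gen_euler_phi 8 (2 ^ v * p ^ a)) \<longleftrightarrow>
    (if v = 0 then p mod 16 \<in> {9, 15} \<or> p mod 16 \<in> {3, 5} \<and> even a \<or> p mod 16 \<in> {11, 13} \<and> odd a
     else if v = 1 then p mod 16 \<in> {7, 9} \<or> p mod 16 \<in> {3, 13} \<and> even a \<or> p mod 16 \<in> {5, 11} \<and> odd a
     else if v = 2 then p mod 8 \<in> {3, 5}
     else v = 3 \<and> p mod 8 \<in> {3, 7})"
proof -
  have "odd (a - 1) \<longleftrightarrow> even a" using assms by simp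
  moreover have "odd (1::nat)" by simp
  ultimately show ?thesis
    unfolding gen_euler_phi_8_prime_power [OF assms] even_add
      even_oct_sum [OF assms(2)] even_oct_sum [OF \<open>odd 1\<close>] two_char_def mod_16_mod [of p]
    using odd_mod_16 [OF assms(2)]
    by (elim insertE emptyE; simp only:; simp)
qed

text \<open>Here the odd part is 1 and the sieve reduces to \<open>oct_sum v 1\<close>; these are
  the exceptional values 8 and 16.\<close>

lemma gen_euler_phi_8_power_2: "odd (gen_euler_phi 8 (2 ^ v)) \<longleftrightarrow> v \<in> {3, 4}"
  using gen_euler_phi_8_parity [of 1 v] even_oct_sum [of 1 v] by auto

section \<open>The classification\<close>

theorem theorem5p1:
  fixes n :: nat
  assumes "n > 0"
  shows "odd (gen_euler_phi 8 n) \<longleftrightarrow>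
      n = 8 \<or> n = 16
    \<or> (\<exists>p \<alpha> :: nat. prime p \<and> odd p \<and> \<alpha> > 0 \<and> n = p ^ \<alpha> \<and>
         (([p = 9] (mod 16) \<or> [p = 15] (mod 16))
          \<or> (([p = 3] (mod 16) \<or> [p = 5] (mod 16)) \<and> even \<alpha>)
          \<or> (([p = 11] (mod 16) \<or> [p = 13] (mod 16)) \<and> odd \<alpha>)))
    \<or> (\<exists>p \<alpha> :: nat. prime p \<and> odd p \<and> \<alpha> > 0 \<and> n = 2 * p ^ \<alpha> \<and>
         (([p = 7] (mod 16) \<or> [p = 9] (mod 16))
          \<or> (([p = 3] (mod 16) \<or> [p = 13] (mod 16)) \<and> even \<alpha>)
          \<or> (([p = 5] (mod 16) \<or> [p = 11] (mod 16)) \<and> odd \<alpha>)))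
    \<or> (\<exists>p \<alpha> :: nat. prime p \<and> odd p \<and> \<alpha> > 0 \<and> n = 4 * p ^ \<alpha> \<and>
         ([p = 3] (mod 8) \<or> [p = 5] (mod 8)))
    \<or> (\<exists>p \<alpha> :: nat. prime p \<and> odd p \<and> \<alpha> > 0 \<and> n = 8 * p ^ \<alpha> \<and>
         ([p = 3] (mod 8) \<or> [p = 7] (mod 8)))
    \<or> (\<exists>p\<^sub>1 p\<^sub>2 \<alpha>\<^sub>1 \<alpha>\<^sub>2 :: nat. prime p\<^sub>1 \<and> odd p\<^sub>1 \<and> prime p\<^sub>2 \<and> odd p\<^sub>2 \<and> p\<^sub>1 \<noteq> p\<^sub>2 \<and>
         \<alpha>\<^sub>1 > 0 \<and> \<alpha>\<^sub>2 > 0 \<and> n = p\<^sub>1 ^ \<alpha>\<^sub>1 * p\<^sub>2 ^ \<alpha>\<^sub>2 \<and>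
         (([p\<^sub>1 = 3] (mod 8) \<and> [p\<^sub>2 = 3] (mod 8))
          \<or> ([p\<^sub>1 = 5] (mod 8) \<and> [p\<^sub>2 = 5] (mod 8))
          \<or> ([p\<^sub>1 = 3] (mod 8) \<and> [p\<^sub>2 = 5] (mod 8))))
    \<or> (\<exists>p\<^sub>1 p\<^sub>2 \<alpha>\<^sub>1 \<alpha>\<^sub>2 :: nat. prime p\<^sub>1 \<and> odd p\<^sub>1 \<and> prime p\<^sub>2 \<and> odd p\<^sub>2 \<and> p\<^sub>1 \<noteq> p\<^sub>2 \<and>
         \<alpha>\<^sub>1 > 0 \<and> \<alpha>\<^sub>2 > 0 \<and> n = 2 * p\<^sub>1 ^ \<alpha>\<^sub>1 * p\<^sub>2 ^ \<alpha>\<^sub>2 \<and>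
         (([p\<^sub>1 = 3] (mod 8) \<and> [p\<^sub>2 = 3] (mod 8))
          \<or> ([p\<^sub>1 = 5] (mod 8) \<and> [p\<^sub>2 = 5] (mod 8))
          \<or> ([p\<^sub>1 = 3] (mod 8) \<and> [p\<^sub>2 = 5] (mod 8))))"
  (is "?L \<longleftrightarrow> _ \<or> _ \<or> ?F1 \<or> ?F2 \<or> ?F3 \<or> ?F4 \<or> ?F5 \<or> ?F6")
proof
  assume odd: ?L
  obtain v m where n: "n = 2 ^ v * m" and m: "odd m"
    using prime_power_canonical [OF two_is_prime_nat assms] by (metis mult.commute)
  have "m > 0" using m by (intro Nat.gr0I) auto
  then have fact: "(\<Prod>p\<in>prime_factors m. p ^ multiplicity p m) = m"
    by (rule prime_factorization_nat [symmetric])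
  have pf: "prime p \<and> odd p \<and> multiplicity p m > 0" if "p \<in> prime_factors m" for p
    using that m dvd_trans [of 2 p m] by (auto simp: prime_factors_multiplicity in_prime_factors_imp_dvd)
  have "card (prime_factors m) < 3"
    using odd gen_euler_phi_8_many_primes [OF m] unfolding n by (meson not_le)
  then consider "card (prime_factors m) = 0" | "card (prime_factors m) = 1" | "card (prime_factors m) = 2"
    by linarith
  then show "n = 8 \<or> n = 16 \<or> ?F1 \<or> ?F2 \<or> ?F3 \<or> ?F4 \<or> ?F5 \<or> ?F6"
  proof cases
    case 1
    then have "m = 1" using fact by simp
    then show ?thesis using odd gen_euler_phi_8_power_2 [of v] by (auto simp: n)
  next
    case 2
    then obtain p where p: "prime_factors m = {p}" by (auto simp: card_1_singleton_iff)
    define a where "a = multiplicity p m"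
    have a: "prime p" "odd p" "a > 0" "m = p ^ a"
      using pf [of p] fact by (simp_all add: p a_def)
    note c = odd [unfolded n a(4) gen_euler_phi_8_prime_power_cases [OF a(1-3)]]
    have "v \<le> 3"
      using c by (rule contrapos_pp) simp
    then consider "v = 0" | "v = 1" | "v = 2" | "v = 3" by linarith
    then show ?thesis
    proof cases
      case 1
      then have ?F1 using a c n by (intro exI [of _ p] exI [of _ a]) (auto simp: cong_def)
      then show ?thesis by blast
    next
      case 2
      then have ?F2 using a c n by (intro exI [of _ p] exI [of _ a]) (auto simp: cong_def)
      then show ?thesis by blast
    next
      case 3
      then have ?F3 using a c n by (intro exI [of _ p] exI [of _ a]) (auto simp: cong_def)
      then show ?thesis by blast
    next
      case 4
      then have ?F4 using a c n by (intro exI [of _ p] exI [of _ a]) (auto simp: cong_def)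
      then show ?thesis by blast
    qed
  next
    case 3
    then obtain x y where xy: "prime_factors m = {x, y}" "x \<noteq> y" by (auto simp: card_2_iff)
    \<comment> \<open>The mixed case is listed only with residue 3 first, so the two primes are
      ordered to exclude residues 5 and 3 in that order.\<close>
    obtain p q where pq: "prime_factors m = {p, q}" "p \<noteq> q" "p mod 8 = 5 \<longrightarrow> q mod 8 \<noteq> 3"
    proof (cases "x mod 8 = 5")
      case True
      then show ?thesis using that [of y x] xy by (auto simp: insert_commute)
    next
      case False
      then show ?thesis using that [of x y] xy by auto
    qed
    define a b where "a = multiplicity p m" and "b = multiplicity q m"
    have ab: "prime p" "odd p" "prime q" "odd q" "p \<noteq> q" "a > 0" "b > 0" "m = p ^ a * q ^ b"
      using pf [of p] pf [of q] pq(2) fact by (simp_all add: pq(1) a_def b_def)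
    have c: "v \<le> 1" "p mod 8 \<in> {3, 5}" "q mod 8 \<in> {3, 5}"
      using odd [unfolded n ab(8) gen_euler_phi_8_two_primes [OF ab(1-7)]] by blast+
    then consider "v = 0" | "v = 1" by linarith
    then show ?thesis
    proof cases
      case 1
      then have ?F5 using ab c n pq(3)
        by (intro exI [of _ p] exI [of _ q] exI [of _ a] exI [of _ b]) (auto simp: cong_def)
      then show ?thesis by blast
    next
      case 2
      then have ?F6 using ab c n pq(3)
        by (intro exI [of _ p] exI [of _ q] exI [of _ a] exI [of _ b]) (auto simp: cong_def)
      then show ?thesis by blast
    qed
  qed
next
  note [simp] = cong_def
  assume "n = 8 \<or> n = 16 \<or> ?F1 \<or> ?F2 \<or> ?F3 \<or> ?F4 \<or> ?F5 \<or> ?F6"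
  then consider "n = 8" | "n = 16" | ?F1 | ?F2 | ?F3 | ?F4 | ?F5 | ?F6 by argo
  then show ?L
  proof cases
    case 1
    then show ?thesis using gen_euler_phi_8_power_2 [of 3] by simp
  next
    case 2
    then show ?thesis using gen_euler_phi_8_power_2 [of 4] by simp
  next
    case 3
    then show ?thesis using gen_euler_phi_8_prime_power_cases [of _ _ 0] by auto
  next
    case 4
    then show ?thesis using gen_euler_phi_8_prime_power_cases [of _ _ 1] by auto
  next
    case 5
    then show ?thesis using gen_euler_phi_8_prime_power_cases [of _ _ 2] by auto
  next
    case 6
    then show ?thesis using gen_euler_phi_8_prime_power_cases [of _ _ 3] by auto
  next
    case 7
    then show ?thesis using gen_euler_phi_8_two_primes [of _ _ _ _ 0] by auto
  next
    case 8
    then show ?thesis using gen_euler_phi_8_two_primes [of _ _ _ _ 1] by (auto simp: mult.assoc)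
  qed
qed

end
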